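(* Let $n\ge 15$ and $2\le k\le n-6$ be integers, and let $M_k$ denote the sum of the $k$ largest binomial coefficients $\binom{n}{i}$, $0\le i\le n$. If $\mathcal{F}$ is a family of subsets of $[n]$ of size $M_k+t$ with $t\ge 0$ an integer, then the number of $k$-chains in $\mathcal{F}$ is at least \[ \binom{n}{\lceil (n-k)/2\rceil}\binom{\lfloor (n+k)/2\rfloor}{k-1}(k-1)! + t\left(\binom{\lceil (n+k)/2\rceil}{k-1}+\binom{\lceil (n+k)/2\rceil}{k}\binom{k}{2}\right)(k-1)!. \]
   Context: A $k$-chain in $\mathcal{F}$ is a collection of $k$ sets $F_1,\dots,F_k\in\mathcal{F}$ with $F_1\subsetneq\cdots\subsetneq F_k$; the number of $k$-chains is the number of such $k$-element subfamilies of $\mathcal{F}$ totally ordered by inclusion. *)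

theory Defs
  imports Complex_Main
begin

definition k_chains :: "nat \<Rightarrow> 'a set set \<Rightarrow> 'a set set set" where
  "k_chains k \<F> = {C. subset.chain \<F> C \<and> card C = k}"

(* The entries of row n of Pascal's triangle are sorted with multiplicity, so equal
   coefficients at different positions i and n - i count separately. *)
definition sum_largest_binomials :: "nat \<Rightarrow> nat \<Rightarrow> nat" where
  "sum_largest_binomials n k = sum_list (take k (rev (sort (map (\<lambda>i. n choose i) [0..<n+1]))))"

end

theory Submission
  imports Defs "HOL-Combinatorics.Multiset_Permutations"
begin

text \<open>
  Let \<open>S\<close> be the set of ranks that a uniformly random maximal chain of the Boolean lattice shares with
  \<open>\<F>\<close>. If every \<open>k\<close>-subset \<open>s\<close> of \<open>S\<close> is weighted by the number of chains with rank set \<open>s\<close>, the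
  expected total weight is the number of \<open>k\<close>-chains in \<open>\<F>\<close>; similarly, weighting each \<open>i \<in> S\<close> by
  \<open>n choose i\<close> gives the expectation \<open>card \<F>\<close>. Hence for any \<open>B\<close> the number of \<open>k\<close>-chains minus
  \<open>B\<close> times the number of sets is minimised by a union of complete layers. Take \<open>B\<close> to be the number of
  \<open>k\<close>-chains that one more set adds to the \<open>k\<close> middle layers. Then the minimum is attained at these
  layers: a layer farthest from the middle among more than \<open>k\<close> layers can be dropped, because its sets
  lie in at least \<open>B\<close> chains each, and unions of at most \<open>k\<close> layers are compared directly. The dropping
  argument needs \<open>k\<close> further layers with ranks between \<open>2\<close> and \<open>n - 2\<close>; without them the union
  contains too few sets to matter.
\<close>

subsection \<open>Averaging over maximal chains\<close>

text \<open>The product of the factorials of the differences of consecutive elements of \<open>{0} \<union> s \<union> {n}\<close>.\<close>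

definition gap_fact :: "nat \<Rightarrow> nat set \<Rightarrow> nat" where
  "gap_fact n s = (\<Prod>x\<in>insert n s. fact (x - Max (insert 0 {y \<in> s. y < x})))"

text \<open>This multinomial coefficient is the number of chains in the subsets of an \<open>n\<close>-set with rank set
  \<open>s\<close>.\<close>

definition level_chains :: "nat \<Rightarrow> nat set \<Rightarrow> real" where
  "level_chains n s = fact n / gap_fact n s"

lemma gap_fact_pos: "gap_fact n s > 0"
  unfolding gap_fact_def by (intro prod_pos) auto

lemma level_chains_nonneg: "level_chains n s \<ge> 0"
  unfolding level_chains_def by simp

lemma gap_fact_empty: "gap_fact n {} = fact n"
  unfolding gap_fact_def by simp

text \<open>Peels off the largest rank: \<open>t\<close> precedes no element of
  \<open>insert t s\<close>, so the factors up to \<open>t\<close> form \<open>gap_fact t s\<close>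
  and only the gap from \<open>t\<close> to \<open>n\<close> is new. For \<open>t = n\<close> that
  gap contributes \<open>fact 0\<close>.\<close>

lemma gap_fact_insert:
  assumes "finite s" "\<And>y. y \<in> s \<Longrightarrow> y < t" "t \<le> n"
  shows "gap_fact n (insert t s) = fact (n - t) * gap_fact t s"
proof -
  have pred: "{y \<in> insert t s. y < x} = {y \<in> s. y < x}" if "x \<in> insert t s" for x
    using assms(2) that by (auto dest: order.strict_trans)
  have *: "(\<Prod>x\<in>insert t s. fact (x - Max (insert 0 {y \<in> insert t s. y < x}))) = gap_fact t s"
    unfolding gap_fact_def by (rule prod.cong[OF refl]) (rule arg_cong[OF pred])
  show ?thesis
  proof (cases "t = n")
    case True
    then show ?thesis using * by (simp add: gap_fact_def)
  next
    case False
    with assms have tn: "t < n" by simp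
    have "n \<notin> insert t s" using tn assms(2) by fastforce
    moreover have "{y \<in> insert t s. y < n} = insert t s"
      using tn assms(2) by (auto dest: order.strict_trans)
    moreover have "Max (insert 0 (insert t s)) = t"
      by (rule Max_eqI) (use assms in \<open>auto intro: less_imp_le\<close>)
    ultimately show ?thesis
      unfolding gap_fact_def[of n] using * assms(1) by simp
  qed
qed

text \<open>Raising \<open>a\<close> by one multiplies the left side by \<open>a + 1\<close> and the
  right side by \<open>a + b\<close>, which is no smaller.\<close>

lemma fact_mult_le_fact:
  assumes "a \<ge> 1" "b \<ge> 1"
  shows "fact a * fact b \<le> (fact (a + b - 1) :: nat)"
  using assms
proof (induction a rule: nat_induct_at_least)
  case base
  then show ?case by simp
next
  case (Suc a)
  have "fact (Suc a) * fact b = Suc a * (fact a * fact b :: nat)" by (simp add: algebra_simps)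
  also have "\<dots> \<le> (a + b) * fact (a + b - 1)" using Suc by (intro mult_mono) auto
  also have "\<dots> = fact (Suc a + b - 1)" using Suc by (cases "a + b") (auto simp: add.commute)
  finally show ?case .
qed

text \<open>A product of factorials of positive integers with a given sum is largest when all but one
  of the integers equal 1.\<close>

lemma gap_fact_le:
  assumes "s \<subseteq> {a..b}" "a \<in> s" "b \<in> s" "b \<le> n"
  shows "gap_fact n s \<le> fact a * fact (n - b) * fact (b - a + 2 - card s)"
proof -
  have "finite s" using assms(1) finite_subset by blast
  then show ?thesis using assms
  proof (induction s arbitrary: b n rule: finite_linorder_max_induct)
    case empty
    then show ?case by simp
  next
    case (insert t s)
    have tb: "t = b"
      using insert.prems insert.hyps by (metis atLeastAtMost_iff insert_iff insert_subset leD)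
    have tn: "t \<le> n" using tb insert.prems by simp
    have "t \<notin> s" using insert.hyps by blast
    have rec: "gap_fact n (insert t s) = fact (n - t) * gap_fact t s"
      using insert.hyps tn by (intro gap_fact_insert) auto
    show ?case
    proof (cases "s = {}")
      case True
      then show ?thesis using rec insert.prems tb by (simp add: gap_fact_empty)
    next
      case False
      define b' where "b' = Max s"
      have b': "b' \<in> s" "s \<subseteq> {a..b'}" "b' < t"
        using False insert.hyps insert.prems by (auto simp: b'_def)
      have at: "a < t" using b' by auto
      then have "a \<in> s" using insert.prems by auto
      then have IH: "gap_fact t s \<le> fact a * fact (t - b') * fact (b' - a + 2 - card s)"
        using b' by (intro insert.IH) auto
      have cs: "card s \<le> b' - a + 1" using card_mono[OF _ b'(2)] by simp
      have ab: "a \<le> b'" using b' by auto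
      \<comment> \<open>The long inner gap of the induction hypothesis merges with the last gap
        \<open>t - b'\<close>, one of the two becoming 1. In general \<open>card s\<close> ranks
        have \<open>card s - 1\<close> gaps of total \<open>b - a\<close>; with all but one equal to
        1, the long one is \<open>b - a + 2 - card s\<close> (for a single rank, the harmless
        \<open>fact 1\<close>).\<close>
      have "fact (t - b') * fact (b' - a + 2 - card s)
          \<le> (fact (t - b' + (b' - a + 2 - card s) - 1) :: nat)"
        using cs b' by (intro fact_mult_le_fact) auto
      also have "t - b' + (b' - a + 2 - card s) - 1 = t - a + 2 - card (insert t s)"
        using cs b'(3) ab card_insert_disjoint[OF insert.hyps(1) \<open>t \<notin> s\<close>] by linarith
      finally have "gap_fact t s \<le> fact a * fact (t - a + 2 - card (insert t s))"
        using IH by (metis (no_types, lifting) mult.assoc mult_le_mono2 order_trans)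
      then show ?thesis using rec tb by (simp add: mult.left_commute)
    qed
  qed
qed

text \<open>A permutation of \<open>V\<close> encodes the maximal chain of its prefixes. If it runs
  through \<open>L\<close>, it splits at the largest member \<open>T\<close> into a permutation of
  \<open>T\<close> through the rest of \<open>L\<close> and an arbitrary one of
  \<open>V - T\<close>; this is the recursion \<open>gap_fact_insert\<close>.\<close>

lemma card_permutations_through_chain:
  assumes "finite V" "subset.chain (Pow V) L"
  shows "card {xs \<in> permutations_of_set V. \<forall>A\<in>L. set (take (card A) xs) = A}
    = gap_fact (card V) (card ` L)"
proof -
  have "finite L" using assms by (meson finite_Pow_iff finite_subset subset_chain_def)
  then show ?thesis using assms
  proof (induction "card L" arbitrary: V L)
    case 0
    then show ?case by (simp add: gap_fact_empty)
  next
    case (Suc q)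
    have "L \<noteq> {}" using Suc.hyps(2) by auto
    then obtain T where T: "T \<in> L" "\<And>A. A \<in> L \<Longrightarrow> T \<subseteq> A \<Longrightarrow> A = T"
      using finite_has_maximal[OF Suc.prems(1)] by blast
    have TV: "T \<subseteq> V" using T Suc.prems by (auto simp: subset_chain_def)
    have fin: "finite T" "finite V" using TV Suc.prems(2) finite_subset by auto
    let ?L = "L - {T}"
    have sub: "A \<subset> T" if "A \<in> ?L" for A
    proof -
      have "A \<subseteq> T \<or> T \<subseteq> A" using that T(1) Suc.prems(3) by (simp add: subset_chain_def)
      then show ?thesis using that T(2)[of A] by blast
    qed
    have lt: "card A < card T" if "A \<in> ?L" for A
      using sub[OF that] fin psubset_card_mono by blast
    have IH: "card {xs \<in> permutations_of_set T. \<forall>A\<in>?L. set (take (card A) xs) = A}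
        = gap_fact (card T) (card ` ?L)"
    proof (rule Suc.hyps(1))
      show "q = card ?L" using T Suc.hyps(2) Suc.prems(1) by simp
      show "subset.chain (Pow T) ?L" using Suc.prems(3) sub by (auto simp: subset_chain_def)
    qed (use Suc.prems fin in auto)
    have eq: "{xs \<in> permutations_of_set V. \<forall>A\<in>L. set (take (card A) xs) = A}
      = (\<lambda>(ys, zs). ys @ zs) ` ({xs \<in> permutations_of_set T. \<forall>A\<in>?L. set (take (card A) xs) = A}
          \<times> permutations_of_set (V - T))" (is "?lhs = ?f ` ?rhs")
    proof (intro equalityI subsetI)
      fix xs assume "xs \<in> ?lhs"
      then have xs: "set xs = V" "distinct xs" "\<And>A. A \<in> L \<Longrightarrow> set (take (card A) xs) = A"
        by (auto simp: permutations_of_set_def)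
      let ?ys = "take (card T) xs" and ?zs = "drop (card T) xs"
      have ys: "set ?ys = T" using xs T by blast
      have "set ?zs = V - T"
      proof -
        have "set ?ys \<union> set ?zs = V" using xs(1) by (metis append_take_drop_id set_append)
        moreover have "set ?ys \<inter> set ?zs = {}"
          using xs(2) by (simp add: set_take_disj_set_drop_if_distinct)
        ultimately show ?thesis using ys by blast
      qed
      moreover have "set (take (card A) ?ys) = A" if "A \<in> ?L" for A
        using xs(3)[of A] that lt[OF that] by (simp add: min_def)
      ultimately have "(?ys, ?zs) \<in> ?rhs"
        using ys xs(2) by (auto simp: permutations_of_set_def)
      then have "?f (?ys, ?zs) \<in> ?f ` ?rhs" by (rule imageI)
      then show "xs \<in> ?f ` ?rhs" by simp
    next
      fix xs assume "xs \<in> ?f ` ?rhs"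
      then obtain ys zs where yz: "xs = ys @ zs" "set ys = T" "distinct ys"
        "\<And>A. A \<in> ?L \<Longrightarrow> set (take (card A) ys) = A" "set zs = V - T" "distinct zs"
        by (auto simp: permutations_of_set_def)
      have len: "length ys = card T" using yz distinct_card by metis
      have "set (take (card A) xs) = A" if "A \<in> L" for A
      proof (cases "A = T")
        case True
        then show ?thesis using len yz by simp
      next
        case False
        then have "A \<in> ?L" using that by simp
        then show ?thesis using lt[of A] yz len by simp
      qed
      then show "xs \<in> ?lhs" using yz TV by (auto simp: permutations_of_set_def)
    qed
    have "inj_on ?f ?rhs"
    proof (rule inj_onI, clarify)
      fix ys zs ys' zs' :: "'a list"
      assume yz: "ys \<in> permutations_of_set T" "ys' \<in> permutations_of_set T" "ys @ zs = ys' @ zs'"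
      then have "length ys = length ys'" by (simp add: length_finite_permutations_of_set)
      then show "ys = ys' \<and> zs = zs'" using yz(3) by simp
    qed
    then have "card ?lhs = gap_fact (card T) (card ` ?L) * fact (card V - card T)"
      unfolding eq using IH fin TV
      by (simp add: card_image card_cartesian_product card_Diff_subset)
    also have "\<dots> = gap_fact (card V) (insert (card T) (card ` ?L))"
      using Suc.prems(1) lt card_mono[OF fin(2) TV] by (subst gap_fact_insert) auto
    also have "insert (card T) (card ` ?L) = card ` L" using T by auto
    finally show ?case .
  qed
qed

text \<open>Double counting of permutations and chains of prefixes: a chain \<open>L\<close> occurs
  in \<open>gap_fact\<close> many permutations and has weight \<open>fact n / gap_fact\<close>, so
  it contributes \<open>fact n\<close> in total, whatever its ranks.\<close>

lemma sum_level_chains_over_permutations: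
  assumes "finite V" "\<F> \<subseteq> Pow V"
  shows "(\<Sum>xs\<in>permutations_of_set V.
      \<Sum>s | s \<subseteq> {j \<in> {..card V}. set (take j xs) \<in> \<F>} \<and> card s = k. level_chains (card V) s)
    = fact (card V) * card (k_chains k \<F>)"
proof -
  let ?P = "permutations_of_set V" and ?n = "card V"
  let ?through = "\<lambda>xs L. \<forall>A\<in>L. set (take (card A) xs) = A"
  have finF: "finite \<F>" using assms finite_subset by auto
  have fin: "finite (k_chains k \<F>)"
    by (rule finite_subset[of _ "Pow \<F>"]) (use finF in \<open>auto simp: k_chains_def subset_chain_def\<close>)
  \<comment> \<open>Along a fixed permutation, a chain of prefixes and its set of ranks determine
    each other.\<close>
  have reindex: "(\<Sum>s | s \<subseteq> {j \<in> {..?n}. set (take j xs) \<in> \<F>} \<and> card s = k. level_chains ?n s)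
      = (\<Sum>L | L \<in> k_chains k \<F> \<and> ?through xs L. level_chains ?n (card ` L))"
    if "xs \<in> ?P" for xs
  proof -
    have xs: "distinct xs" "length xs = ?n" "set xs = V"
      using that by (auto simp: permutations_of_set_def distinct_card)
    have card_take: "card (set (take j xs)) = j" if "j \<le> ?n" for j
      using that xs by (simp add: distinct_card)
    have inj: "inj_on (\<lambda>j. set (take j xs)) s" if "s \<subseteq> {..?n}" for s
      by (rule inj_on_inverseI[of _ card]) (use that card_take in auto)
    have inj': "inj_on card L" if "?through xs L" for L :: "'a set set"
      by (rule inj_on_inverseI[of _ "\<lambda>j. set (take j xs)"]) (use that in auto)
    show ?thesis
    proof (rule sum.reindex_bij_witness[where j = "\<lambda>s. (\<lambda>j. set (take j xs)) ` s"
          and i = "\<lambda>L. card ` L"])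
      fix s assume s: "s \<in> {s. s \<subseteq> {j \<in> {..?n}. set (take j xs) \<in> \<F>} \<and> card s = k}"
      then have sn: "s \<subseteq> {..?n}" by auto
      have "card ` (\<lambda>j. set (take j xs)) ` s = (\<lambda>j. j) ` s"
        unfolding image_image using sn card_take by (intro image_cong) auto
      then show *: "card ` (\<lambda>j. set (take j xs)) ` s = s" by simp
      show "level_chains ?n (card ` (\<lambda>j. set (take j xs)) ` s) = level_chains ?n s"
        unfolding * ..
      have "set (take i xs) \<subseteq> set (take j xs) \<or> set (take j xs) \<subseteq> set (take i xs)" for i j
        using set_take_subset_set_take[of i j xs] set_take_subset_set_take[of j i xs]
          nat_le_linear[of i j] by blast
      then have "subset.chain \<F> ((\<lambda>j. set (take j xs)) ` s)"
        using s unfolding subset_chain_def by blast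
      moreover have "card ((\<lambda>j. set (take j xs)) ` s) = k"
        using s inj[OF sn] by (simp add: card_image)
      ultimately show "(\<lambda>j. set (take j xs)) ` s \<in> {L \<in> k_chains k \<F>. ?through xs L}"
        using card_take sn by (auto simp: k_chains_def)
    next
      fix L assume L: "L \<in> {L \<in> k_chains k \<F>. ?through xs L}"
      have "(\<lambda>j. set (take j xs)) ` card ` L = (\<lambda>A. A) ` L"
        unfolding image_image using L by (intro image_cong) auto
      then show "(\<lambda>j. set (take j xs)) ` card ` L = L" by simp
      show "card ` L \<in> {s. s \<subseteq> {j \<in> {..?n}. set (take j xs) \<in> \<F>} \<and> card s = k}"
        using L assms inj'[of L] by (auto simp: k_chains_def subset_chain_def card_image card_mono)
    qed
  qed
  have "(\<Sum>xs\<in>?P. \<Sum>s | s \<subseteq> {j \<in> {..?n}. set (take j xs) \<in> \<F>} \<and> card s = k. level_chains ?n s)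
      = (\<Sum>xs\<in>?P. \<Sum>L | L \<in> k_chains k \<F> \<and> ?through xs L. level_chains ?n (card ` L))"
    by (intro sum.cong refl reindex)
  also have "\<dots> = (\<Sum>L\<in>k_chains k \<F>. \<Sum>xs | xs \<in> ?P \<and> ?through xs L. level_chains ?n (card ` L))"
    using fin by (intro sum.swap_restrict) auto
  also have "\<dots> = (\<Sum>L\<in>k_chains k \<F>. fact ?n)"
  proof (intro sum.cong refl)
    fix L assume "L \<in> k_chains k \<F>"
    then have "subset.chain (Pow V) L" using assms by (auto simp: k_chains_def subset_chain_def)
    then show "(\<Sum>xs | xs \<in> ?P \<and> ?through xs L. level_chains ?n (card ` L)) = fact ?n"
      using card_permutations_through_chain[OF assms(1)] gap_fact_pos[of ?n "card ` L"]
      by (simp add: level_chains_def)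
  qed
  finally show ?thesis by simp
qed

lemma gap_fact_singleton:
  assumes "j \<le> n"
  shows "gap_fact n {j} = fact j * fact (n - j)"
  using gap_fact_insert[of "{}" j n] assms by (simp add: gap_fact_empty mult.commute)

text \<open>The case \<open>k = 1\<close> of the previous identity: 1-chains are singletons, and a
  single rank \<open>j\<close> has weight \<open>n choose j\<close>.\<close>

lemma sum_binomial_over_permutations:
  assumes "finite V" "\<F> \<subseteq> Pow V"
  shows "(\<Sum>xs\<in>permutations_of_set V.
      \<Sum>j | j \<le> card V \<and> set (take j xs) \<in> \<F>. real (card V choose j))
    = fact (card V) * card \<F>"
proof -
  have "k_chains 1 \<F> = (\<lambda>A. {A}) ` \<F>"
    by (auto simp: k_chains_def subset_chain_def card_1_singleton_iff)
  then have "card (k_chains 1 \<F>) = card \<F>" by (simp add: card_image)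
  moreover have "(\<Sum>s | s \<subseteq> {j \<in> {..card V}. set (take j xs) \<in> \<F>} \<and> card s = 1. level_chains (card V) s)
      = (\<Sum>j | j \<le> card V \<and> set (take j xs) \<in> \<F>. real (card V choose j))" for xs
    by (rule sum.reindex_bij_witness[where j = the_elem and i = "\<lambda>j. {j}"])
      (auto simp: card_1_singleton_iff level_chains_def gap_fact_singleton binomial_fact)
  ultimately show ?thesis
    using sum_level_chains_over_permutations[OF assms, of 1] by simp
qed

subsection \<open>Sums of binomial coefficients\<close>

lemma sum_mset_le_sum_take:
  fixes ys :: "nat list"
  assumes "sorted_wrt (\<ge>) ys" "A \<subseteq># mset ys"
  shows "sum_mset A \<le> sum_list (take (size A) ys)"
  using assms
proof (induction ys arbitrary: A)
  case Nil
  then show ?case by simp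
next
  case (Cons y ys)
  show ?case
  proof (cases "A = {#}")
    case False
    obtain x where x: "x \<in># A" "x \<le> y" "A - {#x#} \<subseteq># mset ys"
    \<comment> \<open>The head \<open>y\<close> is matched with itself if it occurs in
      \<open>A\<close>, otherwise with any element of \<open>A\<close>; either way the rest of
      \<open>A\<close> fits into the tail.\<close>
    proof (cases "y \<in># A")
      case True
      then show ?thesis using that[of y] Cons.prems(2) by (simp add: subset_eq_diff_conv)
    next
      case yA: False
      obtain x where x: "x \<in># A" using False by blast
      have "A \<subseteq># mset ys"
        using Cons.prems(2) subset_eq_diff_conv[of A "{#y#}" "mset ys"]
        unfolding diff_single_trivial[OF yA] by simp
      then have "A - {#x#} \<subseteq># mset ys" "x \<in> set ys"
        using x by (auto intro: subset_mset.order_trans[OF diff_subset_eq_self] dest: mset_subset_eqD)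
      then show ?thesis using that[of x] x Cons.prems(1) by auto
    qed
    obtain B where B: "A = add_mset x B" using x(1) mset_add by metis
    then have "sum_mset B \<le> sum_list (take (size B) ys)"
      using Cons.prems(1) x(3) by (intro Cons.IH) auto
    then show ?thesis using x(2) B by simp
  qed simp
qed

lemma sum_binomial_le_sum_largest:
  assumes "I \<subseteq> {..n}"
  shows "(\<Sum>i\<in>I. n choose i) \<le> sum_largest_binomials n (card I)"
proof -
  let ?xs = "map (\<lambda>i. n choose i) [0..<n+1]"
  have fin: "finite I" using assms finite_subset by blast
  have "mset_set I \<subseteq># mset_set {0..<n+1}"
    using assms by (intro subset_imp_msubset_mset_set) auto
  then have "image_mset (\<lambda>i. n choose i) (mset_set I) \<subseteq># mset (rev (sort ?xs))"
    using image_mset_subseteq_mono by (simp del: upt_Suc) fastforce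
  moreover have "sorted_wrt (\<ge>) (rev (sort ?xs))"
    by (simp add: sorted_wrt_rev del: upt_Suc)
  ultimately have "sum_mset (image_mset (\<lambda>i. n choose i) (mset_set I))
      \<le> sum_list (take (card I) (rev (sort ?xs)))"
    using sum_mset_le_sum_take by fastforce
  then show ?thesis
    unfolding sum_largest_binomials_def by (simp add: sum_unfold_sum_mset)
qed

subsection \<open>Bounds on the number of chains with given ranks\<close>

text \<open>Splitting off \<open>fact p\<close> exposes \<open>n choose p\<close>, the size of a
  layer of rank \<open>p\<close> or \<open>n - p\<close>, so that the other factor acts as a
  degree.\<close>

lemma level_chains_ge:
  assumes "gap_fact n s \<le> fact p * X" "X > 0" "p \<le> n"
  shows "level_chains n s \<ge> (n choose p) * (fact (n - p) / real X)"
proof -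
  have "real (n choose p) * (fact (n - p) / real X) = fact n / (fact p * real X)"
    using assms by (simp add: binomial_fact)
  also have "\<dots> \<le> fact n / real (gap_fact n s)"
  proof (intro divide_left_mono)
    show "real (gap_fact n s) \<le> fact p * real X"
      using assms(1) by (metis of_nat_fact of_nat_le_iff of_nat_mult)
  qed (use gap_fact_pos assms in auto)
  finally show ?thesis by (simp add: level_chains_def)
qed

text \<open>Here \<open>p\<close> and \<open>q\<close> are the distances of the two extreme elements of \<open>s\<close> to \<open>0\<close> and \<open>n\<close>,
  in either order.\<close>

lemma gap_fact_le_ends:
  assumes "s \<subseteq> {x..y}" "x \<in> s" "y \<in> s" "y \<le> n"
    and "p = x \<and> q = n - y \<or> p = n - y \<and> q = x"
  shows "gap_fact n s \<le> fact p * (fact q * fact (n - p - q + 2 - card s))"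
proof -
  have "x \<le> y" using assms by auto
  then have "y - x = n - p - q" using assms(4,5) by auto
  then show ?thesis using gap_fact_le[OF assms(1-4)] assms(5) by (auto simp: mult.assoc mult.left_commute)
qed

text \<open>The outer gap \<open>q\<close> merges with the long inner gap. In the worst case, of the
  \<open>k\<close> gaps other than \<open>p\<close>, all but one are 1 and the last is
  \<open>n - p + 1 - k\<close>.\<close>

lemma level_chains_ge_end:
  assumes "s \<subseteq> {x..y}" "x \<in> s" "y \<in> s" "y \<le> n"
    and "p = x \<and> q = n - y \<or> p = n - y \<and> q = x" "q \<ge> 1" "card s = k" "k \<ge> 1"
  shows "level_chains n s \<ge> (n choose p) * (fact (n - p) / fact (n - p + 1 - k))"
proof -
  have "x \<le> y" using assms by auto
  have "k \<le> y - x + 1" using card_mono[OF _ assms(1)] assms(7) by simp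
  moreover have *: "y - x = n - p - q" "p + q \<le> n" using \<open>x \<le> y\<close> assms(4,5) by auto
  ultimately have "fact q * fact (n - p - q + 2 - k) \<le> (fact (q + (n - p - q + 2 - k) - 1) :: nat)"
    using assms by (intro fact_mult_le_fact) auto
  also have "q + (n - p - q + 2 - k) - 1 = n - p + 1 - k"
    using * \<open>k \<le> y - x + 1\<close> assms(6) by linarith
  finally have "gap_fact n s \<le> fact p * fact (n - p + 1 - k)"
    using gap_fact_le_ends[OF assms(1-5)] assms(7) by (meson mult_le_mono2 order_trans)
  from level_chains_ge[OF this] show ?thesis using * by simp
qed

lemma fact_mult_le_two_fact:
  assumes "a \<ge> 2" "b \<ge> 2"
  shows "fact a * fact b \<le> (2 * fact (a + b - 2) :: nat)"
  using assms
proof (induction a rule: nat_induct_at_least)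
  case base
  then show ?case by (simp add: fact_2)
next
  case (Suc a)
  have "fact (Suc a) * fact b = Suc a * (fact a * fact b :: nat)" by (simp add: algebra_simps)
  also have "\<dots> \<le> (a + b - 1) * (2 * fact (a + b - 2))"
    using Suc.prems Suc.hyps by (intro mult_le_mono Suc.IH) auto
  also have "\<dots> = 2 * fact (Suc a + b - 2)"
  proof -
    obtain c where "a + b = Suc (Suc c)" using Suc by (metis add_2_eq_Suc le_Suc_ex add.assoc)
    then show ?thesis by simp
  qed
  finally show ?case .
qed

text \<open>By \<open>k \<le> y - x\<close>, \<open>s\<close> misses a rank between \<open>x\<close>
  and \<open>y\<close>, so the long inner gap is at least 2, as is \<open>q\<close>. Merging can
  then stop at 2, which gains a factor \<open>(n - p + 1 - k) / 2\<close> over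
  \<open>level_chains_ge_end\<close>.\<close>

lemma level_chains_ge_end_two:
  assumes "s \<subseteq> {x..y}" "x \<in> s" "y \<in> s" "y \<le> n"
    and "p = x \<and> q = n - y \<or> p = n - y \<and> q = x" "q \<ge> 2" "card s = k" "k \<le> y - x"
  shows "level_chains n s \<ge> (n choose p) * (fact (n - p) / (2 * fact (n - p - k)))"
proof -
  have "x \<le> y" using assms by auto
  then have *: "y - x = n - p - q" "p + q \<le> n" using assms(4,5) by auto
  then have "fact q * fact (n - p - q + 2 - k) \<le> (2 * fact (q + (n - p - q + 2 - k) - 2) :: nat)"
    using assms by (intro fact_mult_le_two_fact) auto
  also have "q + (n - p - q + 2 - k) - 2 = n - p - k"
    using * assms(6,8) by linarith
  finally have "gap_fact n s \<le> fact p * (2 * fact (n - p - k))"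
    using gap_fact_le_ends[OF assms(1-5)] assms(7) by (meson mult_le_mono2 order_trans)
  from level_chains_ge[OF this] show ?thesis using * by simp
qed

section \<open>Elementary facts on binomial coefficients\<close>

lemma choose_mult_fact: "j \<le> m \<Longrightarrow> real (m choose j) * fact j = fact m / fact (m - j)"
  by (simp add: binomial_fact)

lemma choose_two_real: "real (m choose 2) = m * (real m - 1) / 2"
proof (cases m)
  case (Suc j)
  have "2 * (Suc j choose 2) = Suc j * (j choose 1)"
    using Suc_times_binomial[of 1 j] by (simp add: numeral_2_eq_2)
  then have "2 * real (Suc j choose 2) = real (Suc j) * real j"
    by (metis choose_one of_nat_mult of_nat_numeral)
  then show ?thesis using Suc by simp
qed simp

lemma three_mult_le_choose_three: "7 \<le> m \<Longrightarrow> 3 * m + 3 \<le> m choose 3"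
proof (induction m rule: nat_induct_at_least)
  case base
  then show ?case by (simp add: numeral_eq_Suc)
next
  case (Suc m)
  have "m choose 1 \<le> m choose 2" using Suc.hyps by (intro binomial_mono) auto
  moreover have "Suc m choose 3 = (m choose 2) + (m choose 3)" by (simp add: numeral_3_eq_3 numeral_2_eq_2)
  ultimately show ?case using Suc by simp
qed

subsection \<open>Unions of complete layers\<close>

text \<open>The last two assumptions say that \<open>l\<close> is \<open>(n - k) / 2\<close> rounded up, so that \<open>l, \<dots>, l + k - 1\<close> are
  \<open>k\<close> middle ranks.\<close>

locale middle_layers =
  fixes n k l :: nat
  assumes k_ge: "2 \<le> k" and l_ge: "3 \<le> l" and n_le: "n \<le> 2 * l + k" and n_ge: "2 * l + k \<le> n + 1"
begin

abbreviation layers_size :: "nat set \<Rightarrow> real" where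
  "layers_size S \<equiv> \<Sum>i\<in>S. real (n choose i)"

abbreviation layers_chains :: "nat set \<Rightarrow> real" where
  "layers_chains S \<equiv> \<Sum>s | s \<subseteq> S \<and> card s = k. level_chains n s"

text \<open>The \<open>k\<close>-chains through a set of rank \<open>l\<close> in the layers \<open>l, \<dots>, l + k - 1\<close>.\<close>

definition bottom_degree :: real where
  "bottom_degree = (n - l choose (k - 1)) * fact (k - 1)"

text \<open>The \<open>k\<close>-chains through a set of rank \<open>l + k\<close> in the layers \<open>l, \<dots>, l + k\<close>: the first summand counts
  those avoiding the layer \<open>l\<close>, the second those avoiding another one.\<close>

definition extra_degree :: real where
  "extra_degree = ((l + k choose (k - 1)) + (l + k choose k) * (k choose 2)) * fact (k - 1)"

text \<open>As \<open>(k choose 2) * fact (k - 1)\<close> is \<open>fact k * (k - 1) / 2\<close>,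
  the degree becomes one bound from \<open>level_chains_ge_end\<close> plus \<open>k - 1\<close>
  bounds from \<open>level_chains_ge_end_two\<close>, with \<open>N = n - p\<close>.\<close>

lemma extra_degree_le:
  assumes "l + k \<le> N"
  shows "extra_degree \<le> fact N / fact (N + 1 - k) + (real k - 1) * (fact N / (2 * fact (N - k)))"
proof -
  have "extra_degree = real (l + k choose (k - 1)) * fact (k - 1)
      + real (l + k choose k) * (real k * fact (k - 1)) * ((real k - 1) / 2)"
    unfolding extra_degree_def by (simp add: choose_two_real algebra_simps)
  also have "real k * fact (k - 1) = fact k" using k_ge by (simp add: fact_reduce)
  also have "real (l + k choose (k - 1)) * fact (k - 1) + real (l + k choose k) * fact k * ((real k - 1) / 2)
      \<le> real (N choose (k - 1)) * fact (k - 1) + real (N choose k) * fact k * ((real k - 1) / 2)"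
    using k_ge by (intro add_mono mult_right_mono) (auto intro: binomial_right_mono[OF assms])
  also have "\<dots> = fact N / fact (N + 1 - k) + fact N / fact (N - k) * ((real k - 1) / 2)"
  proof -
    have "k - 1 \<le> N" "N - (k - 1) = N + 1 - k" using assms k_ge by linarith+
    then have "real (N choose (k - 1)) * fact (k - 1) = fact N / fact (N + 1 - k)"
      using choose_mult_fact[of "k - 1" N] by simp
    moreover have "real (N choose k) * fact k = fact N / fact (N - k)"
      using assms by (intro choose_mult_fact) simp
    ultimately show ?thesis by simp
  qed
  finally show ?thesis by (simp add: mult.commute)
qed

lemma bottom_degree_nonneg: "bottom_degree \<ge> 0"
  unfolding bottom_degree_def by simp

text \<open>By absorption the second summand of \<open>extra_degree\<close> is
  \<open>(l + 1) * (k - 1) / 2\<close> times the first, hence at least twice it.\<close>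

lemma extra_degree_ge: "extra_degree \<ge> 3 * bottom_degree"
proof -
  let ?c1 = "l + k choose (k - 1)" and ?c2 = "l + k choose k"
  have "k * ?c2 = (l + k) * (l + k - 1 choose (k - 1))"
    using k_ge by (intro times_binomial_minus1_eq) auto
  also have "\<dots> = (l + k - (k - 1)) * ?c1" by (rule binomial_absorb_comp[symmetric])
  also have "l + k - (k - 1) = l + 1" using k_ge by simp
  finally have "real k * ?c2 = (real l + 1) * ?c1" by (metis of_nat_1 of_nat_add of_nat_mult)
  then have "?c2 * real (k choose 2) = (real l + 1) * (real k - 1) / 2 * ?c1"
    by (simp add: choose_two_real algebra_simps)
  moreover have "4 * 1 \<le> (real l + 1) * (real k - 1)"
    using l_ge k_ge by (intro mult_mono) auto
  then have "2 * real ?c1 \<le> (real l + 1) * (real k - 1) / 2 * ?c1"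
    by (intro mult_right_mono) auto
  ultimately have "3 * real ?c1 \<le> ?c1 + ?c2 * real (k choose 2)" by simp
  moreover have "(n - l choose (k - 1)) \<le> ?c1"
    using n_le by (intro binomial_right_mono) auto
  ultimately have "3 * real (n - l choose (k - 1)) \<le> ?c1 + ?c2 * real (k choose 2)" by linarith
  then have "3 * real (n - l choose (k - 1)) * fact (k - 1) \<le> (?c1 + ?c2 * real (k choose 2)) * fact (k - 1)"
    by (intro mult_right_mono) auto
  then show ?thesis unfolding extra_degree_def bottom_degree_def by simp
qed

lemma extra_degree_nonneg: "extra_degree \<ge> 0"
  using extra_degree_ge bottom_degree_nonneg by linarith

section \<open>Comparison of layers with the middle ones\<close>

lemma binomial_le_middle:
  assumes "p \<le> l" "j = p \<or> j = n - p"
  shows "n choose j \<le> n choose l"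
proof -
  have "p \<le> n" "2 * l \<le> n" using assms n_ge k_ge by linarith+
  then show ?thesis using assms binomial_mono[of p l n] binomial_symmetric[of p n] by auto
qed

lemma binomial_ge_middle:
  assumes "j \<in> {l..<l + k}"
  shows "n choose l \<le> n choose j"
proof (cases "2 * j \<le> n")
  case True
  then show ?thesis using assms by (intro binomial_mono) auto
next
  case False
  have "j \<le> n" "l \<le> n - j" using assms n_ge l_ge by auto
  then show ?thesis using False binomial_mono[of l "n - j" n] binomial_symmetric[of j n] by auto
qed

text \<open>Exchange argument: layers of \<open>R\<close> outside the middle have at most
  \<open>n choose l\<close> sets, middle layers missing from \<open>R\<close> at least that many,
  and there are \<open>k - card R\<close> more of the latter.\<close>

lemma layers_size_le:
  assumes "R \<subseteq> {..n}" "card R \<le> k"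
  shows "layers_size R \<le> layers_size {l..<l + k} - (real k - card R) * (n choose l)"
proof -
  let ?L = "{l..<l + k}" and ?c = "real (n choose l)"
  have fin: "finite R" using assms(1) finite_subset by blast
  have "n choose j \<le> n choose l" if "j \<in> R - ?L" for j
  proof (cases "j < l")
    case True
    then show ?thesis by (intro binomial_le_middle[of j]) auto
  next
    case False
    then have "n - j \<le> l" "n - (n - j) = j" using that assms(1) n_le by auto
    then show ?thesis by (intro binomial_le_middle[of "n - j"]) auto
  qed
  then have "layers_size (R - ?L) \<le> card (R - ?L) * ?c"
    by (intro sum_bounded_above) auto
  moreover have "card (?L - R) * ?c \<le> layers_size (?L - R)"
    using binomial_ge_middle by (intro sum_bounded_below) auto
  moreover have "real (card (?L - R)) = card (R - ?L) + (real k - card R)"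
    using card_Int_Diff[OF fin, of ?L] card_Int_Diff[of ?L R] by (simp add: Int_commute)
  then have "card (?L - R) * ?c = card (R - ?L) * ?c + (real k - card R) * ?c"
    by (metis distrib_right)
  moreover have "layers_size R = layers_size (R \<inter> ?L) + layers_size (R - ?L)"
    using fin by (simp add: sum.Int_Diff)
  moreover have "layers_size ?L = layers_size (R \<inter> ?L) + layers_size (?L - R)"
    using sum.Int_Diff[of ?L "\<lambda>i. real (n choose i)" R] by (simp add: Int_commute)
  ultimately show ?thesis by linarith
qed

text \<open>Each of the \<open>k\<close> ways to omit a layer of \<open>T\<close> is bounded separately. The one that omits the layer
  opposite to \<open>e\<close> gives the first summand of \<open>extra_degree_le\<close>, the others one share of the second.\<close>

lemma chains_through_end_ge:
  assumes "S \<subseteq> {..n}" "e \<in> S" "T \<subseteq> S - {e}" "card T = k" "e = p \<or> e = n - p" "p \<le> n"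
    and "T \<subseteq> {max p 2..n - max p 2}"
  shows "extra_degree * (n choose p) \<le> (\<Sum>s | s \<subseteq> S \<and> e \<in> s \<and> card s = k. level_chains n s)"
proof -
  let ?\<alpha> = "(n choose p) * (fact (n - p) / (2 * fact (n - p - k)))"
  let ?\<beta> = "(n choose p) * (fact (n - p) / fact (n - p + 1 - k))"
  let ?g = "\<lambda>j. level_chains n (insert e (T - {j}))"
  have fin: "finite T" "finite S" using assms(1,3) by (auto intro: finite_subset[of _ "{..n}"])
  have T0: "T \<noteq> {}" using assms(4) k_ge by auto
  have eT: "e \<notin> T" using assms(3) by auto
  have "insert e T \<subseteq> {p..n - p}" using assms(5-7) T0 by fastforce
  then have "card (insert e T) \<le> card {p..n - p}" by (intro card_mono) auto
  then have kp: "k + p \<le> n - p" "k + 2 * p \<le> n" using eT fin assms(4) by auto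
  \<comment> \<open>Add \<open>k + 2 * p \<le> n\<close> to \<open>2 * l + k \<le> n + 1\<close> and
    halve; parity absorbs the 1.\<close>
  then have N: "l + k \<le> n - p" using n_le n_ge by linarith
  have card: "card (insert e (T - {j})) = k" if "j \<in> T" for j
    using that eT fin assms(4) k_ge by auto
  have T1: "T - {j} \<noteq> {}" for j
  proof
    assume "T - {j} = {}"
    then have "card T \<le> card {j}" by (intro card_mono) auto
    then show False using assms(4) k_ge by simp
  qed
  have "\<exists>i\<in>T. ?\<beta> \<le> ?g i \<and> (\<forall>j\<in>T - {i}. ?\<alpha> \<le> ?g j)"
  proof (cases "e = p")
    case True
    have lt: "p < j" if "j \<in> T" for j
      using that True eT assms(7)
      by (metis atLeastAtMost_iff le_neq_implies_less max.bounded_iff subsetD)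
    define b where "b = Max T"
    have b: "b \<in> T" "\<And>j. j \<in> T \<Longrightarrow> j \<le> b" using T0 fin by (auto simp: b_def)
    have "b \<le> n - max p 2" using b(1) assms(7) by auto
    then have bn: "b \<le> n" "n - b \<ge> 2" using n_ge l_ge by linarith+
    \<comment> \<open>Without \<open>b\<close> the remaining ranks may be consecutive, so only the
      weaker bound is available.\<close>
    have "?\<beta> \<le> ?g b"
    proof (rule level_chains_ge_end[where x = p and y = "Max (T - {b})" and q = "n - Max (T - {b})"])
      have m: "Max (T - {b}) \<in> T - {b}" using fin T1 by (intro Max_in) auto
      have "p < j \<and> j \<le> Max (T - {b})" if "j \<in> T - {b}" for j using that fin lt by auto
      then show "insert e (T - {b}) \<subseteq> {p..Max (T - {b})}" using True m by fastforce
      show "Max (T - {b}) \<in> insert e (T - {b})" using m by blast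
      have "Max (T - {b}) < b" using m b(2) by fastforce
      then show "Max (T - {b}) \<le> n" "1 \<le> n - Max (T - {b})" using bn by auto
    qed (use True card b k_ge in auto)
    \<comment> \<open>Here \<open>b\<close> remains and \<open>j\<close> is a missing rank between
      \<open>p\<close> and \<open>b\<close>; \<open>n - b \<ge> 2\<close> holds because
      \<open>T\<close> avoids the ranks above \<open>n - 2\<close>.\<close>
    moreover have "?\<alpha> \<le> ?g j" if "j \<in> T - {b}" for j
    proof (rule level_chains_ge_end_two[where x = p and y = b and q = "n - b"])
      have "insert e T \<subseteq> {p..b}" using b less_imp_le[OF lt] True by auto
      then have "card (insert e T) \<le> card {p..b}" by (intro card_mono) auto
      then show "k \<le> b - p" using eT fin assms(4) lt[OF b(1)] by simp
      show "insert e (T - {j}) \<subseteq> {p..b}" using \<open>insert e T \<subseteq> {p..b}\<close> by auto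
    qed (use True card b bn that in auto)
    ultimately show ?thesis using b(1) by blast
  next
    \<comment> \<open>The mirror image, with the minimum of \<open>T\<close> in the role of
      \<open>b\<close>.\<close>
    case False
    then have e: "e = n - p" using assms(5) by simp
    have lt: "j < n - p" if "j \<in> T" for j
    proof -
      have "j \<noteq> e" using that eT by auto
      moreover have "j \<le> n - max p 2" using that assms(7) by auto
      ultimately show ?thesis using e by linarith
    qed
    define a where "a = Min T"
    have a: "a \<in> T" "\<And>j. j \<in> T \<Longrightarrow> a \<le> j" using T0 fin by (auto simp: a_def)
    have a2: "a \<ge> 2" using a(1) assms(7) by auto
    have "?\<beta> \<le> ?g a"
    proof (rule level_chains_ge_end[where y = "n - p" and x = "Min (T - {a})" and q = "Min (T - {a})"])
      have m: "Min (T - {a}) \<in> T - {a}" using fin T1 by (intro Min_in) auto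
      have "j < n - p \<and> Min (T - {a}) \<le> j" if "j \<in> T - {a}" for j using that fin lt by auto
      then show "insert e (T - {a}) \<subseteq> {Min (T - {a})..n - p}" using e m by fastforce
      show "Min (T - {a}) \<in> insert e (T - {a})" using m by blast
      have "a < Min (T - {a})" using m a(2) by fastforce
      then show "1 \<le> Min (T - {a})" by auto
    qed (use e card a k_ge assms(6) in auto)
    moreover have "?\<alpha> \<le> ?g j" if "j \<in> T - {a}" for j
    proof (rule level_chains_ge_end_two[where y = "n - p" and x = a and q = a])
      have "insert e T \<subseteq> {a..n - p}" using a less_imp_le[OF lt] e by auto
      then have "card (insert e T) \<le> card {a..n - p}" by (intro card_mono) auto
      then show "k \<le> n - p - a" using eT fin assms(4) lt[OF a(1)] by simp
      show "insert e (T - {j}) \<subseteq> {a..n - p}" using \<open>insert e T \<subseteq> {a..n - p}\<close> by auto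
    qed (use e card a a2 that assms(6) in auto)
    ultimately show ?thesis using a(1) by blast
  qed
  then obtain i where i: "i \<in> T" "?\<beta> \<le> ?g i" "\<And>j. j \<in> T - {i} \<Longrightarrow> ?\<alpha> \<le> ?g j" by blast
  have "extra_degree * (n choose p) \<le> ?\<beta> + (real k - 1) * ?\<alpha>"
    using mult_right_mono[OF extra_degree_le[OF N], of "n choose p"] by (simp add: algebra_simps)
  also have "(real k - 1) * ?\<alpha> = card (T - {i}) * ?\<alpha>"
    using i(1) fin assms(4) k_ge by (simp add: of_nat_diff)
  also have "\<dots> \<le> (\<Sum>j\<in>T - {i}. ?g j)" using i(3) by (intro sum_bounded_below) auto
  also have "?\<beta> + (\<Sum>j\<in>T - {i}. ?g j) \<le> (\<Sum>j\<in>T. ?g j)"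
    using i(1,2) fin by (simp add: sum.remove[of T i])
  also have "(\<Sum>j\<in>T. ?g j) = (\<Sum>s\<in>(\<lambda>j. insert e (T - {j})) ` T. level_chains n s)"
  proof (subst sum.reindex)
    show "inj_on (\<lambda>j. insert e (T - {j})) T"
    proof (rule inj_onI)
      fix i j assume "i \<in> T" and "insert e (T - {i}) = insert e (T - {j})"
      moreover have "i \<notin> insert e (T - {i})" using \<open>i \<in> T\<close> eT by auto
      ultimately show "i = j" by auto
    qed
  qed simp
  also have "\<dots> \<le> (\<Sum>s | s \<subseteq> S \<and> e \<in> s \<and> card s = k. level_chains n s)"
  proof (rule sum_mono2)
    show "finite {s. s \<subseteq> S \<and> e \<in> s \<and> card s = k}" using fin by simp
    show "(\<lambda>j. insert e (T - {j})) ` T \<subseteq> {s. s \<subseteq> S \<and> e \<in> s \<and> card s = k}"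
      using assms(2,3) card by auto
  qed (rule level_chains_nonneg)
  finally show ?thesis by simp
qed

text \<open>The left side is three halves of \<open>2 * n + 2\<close>, the total size of the four
  outermost layers.\<close>

lemma middle_binomial_ge: "3 * n + 3 \<le> n choose l"
proof -
  have "7 \<le> n" using n_ge l_ge k_ge by linarith
  then have "3 * n + 3 \<le> n choose 3" by (rule three_mult_le_choose_three)
  also have "\<dots> \<le> n choose l" using n_ge l_ge k_ge by (intro binomial_mono) auto
  finally show ?thesis .
qed

lemma layers_size_ends_le:
  assumes "S \<subseteq> {..n}"
  shows "layers_size (S - {2..n - 2}) \<le> 2 * n + 2"
proof -
  have "7 \<le> n" using n_ge l_ge k_ge by linarith
  have "S - {2..n - 2} \<subseteq> {0, 1, n - 1, n}" using assms by auto
  then have "layers_size (S - {2..n - 2}) \<le> layers_size {0, 1, n - 1, n}"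
    by (intro sum_mono2) auto
  also have "\<dots> = 2 * n + 2"
    using \<open>7 \<le> n\<close> binomial_symmetric[of 1 n] by simp
  finally show ?thesis .
qed

text \<open>Any \<open>k - 1\<close> layers fall short of the \<open>k\<close> middle ones by at least the smallest of these, and the
  at most four other layers, of ranks \<open>0\<close>, \<open>1\<close>, \<open>n - 1\<close>, \<open>n\<close>, recover at most two thirds of that.\<close>

lemma layers_chains_ge_no_middle:
  assumes "S \<subseteq> {..n}" "card (S \<inter> {2..n - 2}) < k"
  shows "(n choose l) * bottom_degree + extra_degree * (layers_size S - layers_size {l..<l + k})
    \<le> layers_chains S"
proof -
  let ?c = "real (n choose l)" and ?M = "S \<inter> {2..n - 2}"
  have fin: "finite S" using assms(1) finite_subset by blast
  have "layers_size ?M \<le> layers_size {l..<l + k} - (real k - card ?M) * ?c"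
    using assms by (intro layers_size_le) auto
  moreover have "1 * ?c \<le> (real k - card ?M) * ?c"
    using assms(2) by (intro mult_right_mono) auto
  moreover have "layers_size S = layers_size ?M + layers_size (S - {2..n - 2})"
    using fin by (rule sum.Int_Diff)
  moreover have "3 * real n + 3 \<le> ?c"
    using middle_binomial_ge by (metis of_nat_add of_nat_le_iff of_nat_mult of_nat_numeral)
  ultimately have "layers_size S - layers_size {l..<l + k} \<le> - (?c / 3)"
    using layers_size_ends_le[OF assms(1)] by linarith
  then have "extra_degree * (layers_size S - layers_size {l..<l + k}) \<le> extra_degree * - (?c / 3)"
    using extra_degree_nonneg by (rule mult_left_mono)
  moreover have "?c * (3 * bottom_degree) \<le> ?c * extra_degree"
    using extra_degree_ge by (intro mult_left_mono) auto
  moreover have "0 \<le> layers_chains S" by (intro sum_nonneg level_chains_nonneg)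
  ultimately show ?thesis by (simp add: algebra_simps)
qed

text \<open>Induction on the number of layers. With more than \<open>k\<close> layers, the one
  nearest to \<open>0\<close> or \<open>n\<close> is removed: the size drops by
  \<open>n choose p\<close>, the chains by at least \<open>extra_degree\<close> times that.\<close>

lemma layers_chains_ge:
  assumes "S \<subseteq> {..n}"
  shows "(n choose l) * bottom_degree + extra_degree * (layers_size S - layers_size {l..<l + k})
    \<le> layers_chains S"
  using assms
proof (induction "card S" arbitrary: S rule: less_induct)
  case less
  let ?c = "real (n choose l)" and ?M = "S \<inter> {2..n - 2}"
  have fin: "finite S" using less.prems finite_subset by blast
  show ?case
  proof (cases "card ?M < k")
    case True
    then show ?thesis using less.prems by (rule layers_chains_ge_no_middle[rotated])
  next
    case False
    then have M: "k \<le> card ?M" by simp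
    then have "S \<noteq> {}" using k_ge by auto
    define x where "x = Min S"
    define y where "y = Max S"
    have xy: "x \<in> S" "y \<in> S" "S \<subseteq> {x..y}" "y \<le> n"
      using \<open>S \<noteq> {}\<close> fin less.prems Max_in[OF fin \<open>S \<noteq> {}\<close>] by (auto simp: x_def y_def)
    obtain e p q where e: "e = x \<and> p = x \<and> q = n - y \<or> e = y \<and> p = n - y \<and> q = x" "p \<le> q"
      using nat_le_linear by metis
    have "x \<le> y" using xy by auto
    have eS: "e \<in> S" and ep: "e = p \<or> e = n - p" and pn: "p \<le> n"
      using e xy \<open>x \<le> y\<close> by auto
    have "{x..y} \<subseteq> {p..n - p}" using e xy(4) \<open>x \<le> y\<close> by auto
    with xy(3) have Sp: "S \<subseteq> {p..n - p}" by (rule subset_trans)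
    have size: "layers_size S = layers_size (S - {e}) + (n choose p)"
    proof -
      have "n choose e = n choose p" using ep binomial_symmetric[OF pn] by metis
      then show ?thesis using sum.remove[OF fin eS, of "\<lambda>i. real (n choose i)"] by simp
    qed
    show ?thesis
    proof (cases "card S = k")
      case True
      then have SM: "S = ?M" using M fin by (metis Int_lower1 card_seteq)
      have "x \<in> {2..n - 2}" "y \<in> {2..n - 2}" using xy(1,2) SM by blast+
      then have "1 \<le> q" using e by auto
      have "card S \<le> card {p..n - p}" using Sp by (intro card_mono) auto
      then have "p \<le> l" using True n_le k_ge by auto
      have "bottom_degree \<le> (n - p choose (k - 1)) * fact (k - 1)"
        unfolding bottom_degree_def using \<open>p \<le> l\<close>
        by (intro of_nat_mono mult_right_mono binomial_right_mono) auto
      also have "\<dots> = fact (n - p) / fact (n - p + 1 - k)"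
      proof -
        have "k - 1 \<le> n - p" "n - p - (k - 1) = n - p + 1 - k" using n_ge k_ge l_ge \<open>p \<le> l\<close> by linarith+
        then show ?thesis by (metis choose_mult_fact of_nat_fact of_nat_mult)
      qed
      finally have "(n choose p) * bottom_degree \<le> (n choose p) * (fact (n - p) / fact (n - p + 1 - k))"
        by (intro mult_left_mono) auto
      also have "\<dots> \<le> level_chains n S"
        using xy e \<open>1 \<le> q\<close> True k_ge by (intro level_chains_ge_end[of S x y]) auto
      also have "\<dots> = (\<Sum>s\<in>{S}. level_chains n s)" by simp
      also have "\<dots> \<le> layers_chains S"
        using True fin by (intro sum_mono2 level_chains_nonneg) auto
      finally have 1: "(n choose p) * bottom_degree \<le> layers_chains S" .
      have "layers_size (S - {e}) \<le> layers_size {l..<l + k} - (real k - card (S - {e})) * ?c"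
        using less.prems True by (intro layers_size_le) (auto simp: card_Diff_subset_Int)
      moreover have "real k - card (S - {e}) = 1" using True eS fin k_ge by simp
      ultimately have "layers_size S - layers_size {l..<l + k} \<le> (n choose p) - ?c"
        using size by simp
      then have 2: "extra_degree * (layers_size S - layers_size {l..<l + k}) \<le> extra_degree * ((n choose p) - ?c)"
        using extra_degree_nonneg by (rule mult_left_mono)
      have "n choose p \<le> n choose l" using \<open>p \<le> l\<close> by (intro binomial_le_middle[of p]) auto
      \<comment> \<open>Facts 1 and 2 reduce the claim to this: each of the
        \<open>?c - (n choose p)\<close> sets fewer may cost \<open>bottom_degree\<close> chains,
        but the bound allows for \<open>extra_degree\<close>.\<close>
      then have "0 \<le> (extra_degree - bottom_degree) * (?c - (n choose p))"
        using extra_degree_ge bottom_degree_nonneg by (intro mult_nonneg_nonneg) auto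
      then show ?thesis using 1 2 by (simp add: algebra_simps)
    next
      case False
      have "card ?M \<le> card S" using fin by (intro card_mono) auto
      then have S_gt: "k < card S" using M False by simp
      have "k \<le> card (?M - {e})"
      \<comment> \<open>If the outermost rank \<open>e\<close> lies in \<open>{2..n - 2}\<close>, so
        does all of \<open>S\<close>, which has a layer to spare.\<close>
      proof (cases "e \<in> ?M")
        case True
        then have "2 \<le> p" using ep by auto
        then have "{p..n - p} \<subseteq> {2..n - 2}" by auto
        with Sp have "S \<subseteq> {2..n - 2}" by (rule subset_trans)
        then have "?M = S" by auto
        then show ?thesis using S_gt eS fin by simp
      qed (use M in simp)
      then obtain T where T: "T \<subseteq> ?M - {e}" "card T = k"
        using obtain_subset_with_card_n by metis
      have "extra_degree * (n choose p) \<le> (\<Sum>s | s \<subseteq> S \<and> e \<in> s \<and> card s = k. level_chains n s)"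
      proof (rule chains_through_end_ge[where T = T])
        show "T \<subseteq> {max p 2..n - max p 2}" using T(1) Sp by (auto simp: max_def)
      qed (use less.prems eS T ep pn in auto)
      moreover have "layers_chains S = layers_chains (S - {e})
          + (\<Sum>s | s \<subseteq> S \<and> e \<in> s \<and> card s = k. level_chains n s)"
        using fin by (subst sum.union_disjoint[symmetric]) (auto intro!: sum.cong)
      moreover have "(n choose l) * bottom_degree
          + extra_degree * (layers_size (S - {e}) - layers_size {l..<l + k}) \<le> layers_chains (S - {e})"
        using less.prems by (intro less.hyps card_Diff1_less[OF fin eS]) auto
      ultimately show ?thesis unfolding size by (simp add: algebra_simps)
    qed
  qed
qed

text \<open>\<open>layers_chains_ge\<close> is summed over the rank sets that all permutations share
  with \<F>; the two averaging identities evaluate both sides.\<close>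

lemma k_chains_ge:
  assumes "finite V" "card V = n" "\<F> \<subseteq> Pow V"
  shows "(n choose l) * bottom_degree + extra_degree * (card \<F> - layers_size {l..<l + k})
    \<le> card (k_chains k \<F>)"
proof -
  let ?P = "permutations_of_set V"
  let ?S = "\<lambda>xs. {j \<in> {..n}. set (take j xs) \<in> \<F>}"
  have "fact n * ((n choose l) * bottom_degree + extra_degree * (card \<F> - layers_size {l..<l + k}))
    = (\<Sum>xs\<in>?P. (n choose l) * bottom_degree - extra_degree * layers_size {l..<l + k})
      + extra_degree * (fact n * card \<F>)"
    using assms(1,2) by (simp add: algebra_simps)
  also have "real (fact n * card \<F>) = (\<Sum>xs\<in>?P. layers_size (?S xs))"
    using sum_binomial_over_permutations[OF assms(1,3)] assms(2) by simp
  also have "(\<Sum>xs\<in>?P. (n choose l) * bottom_degree - extra_degree * layers_size {l..<l + k})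
      + extra_degree * (\<Sum>xs\<in>?P. layers_size (?S xs))
    = (\<Sum>xs\<in>?P. (n choose l) * bottom_degree
        + extra_degree * (layers_size (?S xs) - layers_size {l..<l + k}))"
    by (simp add: right_diff_distrib sum.distrib sum_subtractf sum_distrib_left[symmetric] algebra_simps)
  also have "\<dots> \<le> (\<Sum>xs\<in>?P. layers_chains (?S xs))"
    by (intro sum_mono layers_chains_ge) auto
  also have "\<dots> = fact n * card (k_chains k \<F>)"
    using sum_level_chains_over_permutations[OF assms(1,3), of k] assms(2) by simp
  finally show ?thesis by simp
qed

end

theorem theorem1p4:
  fixes n k t :: nat and \<F> :: "nat set set"
  assumes "n \<ge> 15" and "2 \<le> k" and "k \<le> n - 6"
    and "\<F> \<subseteq> Pow {1..n}"
    and "card \<F> = sum_largest_binomials n k + t"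
  shows "card (k_chains k \<F>) \<ge>
      (n choose nat \<lceil>(real n - real k) / 2\<rceil>)
        * (nat \<lfloor>(real n + real k) / 2\<rfloor> choose (k - 1)) * fact (k - 1)
      + t * ((nat \<lceil>(real n + real k) / 2\<rceil> choose (k - 1))
             + (nat \<lceil>(real n + real k) / 2\<rceil> choose k) * (k choose 2)) * fact (k - 1)"
proof -
  define l where "l = (n - k + 1) div 2"
  \<comment> \<open>The gap of 6 between \<open>k\<close> and \<open>n\<close> yields
    \<open>3 \<le> l\<close>.\<close>
  have "k + 6 \<le> n" using assms(1,3) by simp
  then have l: "n \<le> 2 * l + k" "2 * l + k \<le> n + 1" "3 \<le> l" by (auto simp: l_def)
  interpret middle_layers n k l using assms l by unfold_locales auto
  have "real n \<le> 2 * real l + real k" "2 * real l + real k \<le> real n + 1"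
    using l by linarith+
  then have "\<lceil>(real n - real k) / 2\<rceil> = int l" "\<lceil>(real n + real k) / 2\<rceil> = int (l + k)"
    "\<lfloor>(real n + real k) / 2\<rfloor> = int n - int l"
    by (auto simp: ceiling_eq_iff floor_eq_iff)
  then have nat_eqs: "nat \<lceil>(real n - real k) / 2\<rceil> = l" "nat \<lceil>(real n + real k) / 2\<rceil> = l + k"
    "nat \<lfloor>(real n + real k) / 2\<rfloor> = n - l"
    by auto
  \<comment> \<open>The surplus of \<F> over the middle layers is therefore at least
    \<open>t\<close>, and its coefficient \<open>extra_degree\<close> is nonnegative.\<close>
  have "(\<Sum>i\<in>{l..<l + k}. n choose i) \<le> sum_largest_binomials n (card {l..<l + k})"
    using l by (intro sum_binomial_le_sum_largest) auto
  then have "layers_size {l..<l + k} \<le> sum_largest_binomials n k"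
    by (metis add_diff_cancel_left' card_atLeastLessThan of_nat_le_iff of_nat_sum)
  then have "extra_degree * t \<le> extra_degree * (card \<F> - layers_size {l..<l + k})"
    using assms(5) extra_degree_nonneg by (intro mult_left_mono) auto
  then have "(n choose l) * bottom_degree + extra_degree * t \<le> card (k_chains k \<F>)"
    using k_chains_ge[of "{1..n}" \<F>] assms(4) by simp
  then have "real ((n choose l) * (n - l choose (k - 1)) * fact (k - 1)
      + t * ((l + k choose (k - 1)) + (l + k choose k) * (k choose 2)) * fact (k - 1))
      \<le> real (card (k_chains k \<F>))"
    unfolding bottom_degree_def extra_degree_def by (simp add: algebra_simps)
  then show ?thesis unfolding nat_eqs of_nat_le_iff .
qed

end
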